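(* Let $m,n\ge 1$ be integers with $m+1\le n$ and let $A_1,\dots,A_m\in S^n$ satisfy $$\max_{1\le i\le m,\ x^TA_ix\neq 0} x_i\,(x^TA_ix)\ \ge\ 0\quad\text{for all } x\in R^n \text{ with } \|x\|=1 \text{ and } x_n<0 .$$ Then the system $$\langle A_i,X\rangle=0,\quad i=1,\dots,m,\qquad X\succeq 0,\qquad X\in S^n,$$ has a rank-one solution.
   Context: $S^n$ is the set of real symmetric $n\times n$ matrices; $\langle X,Y\rangle=\mathrm{tr}(X^TY)$; $X\succeq 0$ means positive semidefinite; $\|x\|$ is the Euclidean norm and $x_i$ the $i$th component of $x\in R^n$. A rank-one solution is a solution $X$ of the system with $\mathrm{rank}(X)=1$. In the hypothesis, for each such $x$ the maximum is taken over those indices $i\in\{1,\dots,m\}$ with $x^TA_ix\ne 0$; if for some $x$ there is no such index, the condition is regarded as holding for that $x$. *)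

theory Defs
  imports "HOL-Analysis.Analysis"
begin

definition sym_mats :: "(real ^ 'n ^ 'n) set"
  where "sym_mats = {X. transpose X = X}"

definition mat_inner :: "real ^ 'n ^ 'n \<Rightarrow> real ^ 'n ^ 'n \<Rightarrow> real"
  where "mat_inner X Y = trace (transpose X ** Y)"

text \<open>Symmetry is not part of this predicate; it is required separately
  through \<^const>\<open>sym_mats\<close>.\<close>

definition pos_semidef :: "real ^ 'n ^ 'n \<Rightarrow> bool"
  where "pos_semidef X \<longleftrightarrow> (\<forall>v. 0 \<le> v \<bullet> (X *v v))"

definition quad_form :: "real ^ 'n ^ 'n \<Rightarrow> real ^ 'n \<Rightarrow> real"
  where "quad_form A x = x \<bullet> (A *v x)"

definition is_solution :: "nat \<Rightarrow> (nat \<Rightarrow> real ^ 'n ^ 'n) \<Rightarrow> real ^ 'n ^ 'n \<Rightarrow> bool"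
  where "is_solution m A X \<longleftrightarrow>
    (\<forall>i\<in>{1..m}. mat_inner (A i) X = 0) \<and> pos_semidef X \<and> X \<in> sym_mats"

text \<open>The dimension is \<open>n = CARD('n)\<close>. The hypothesis pairs the matrix index \<open>i\<close> with the
  \<open>i\<close>th coordinate, so the coordinates must be numbered: \<open>e\<close> is a bijection from
  \<open>{1..n}\<close> onto the index type, and the \<open>i\<close>th component of \<open>x\<close> is \<open>x $ e i\<close>.
  The nonemptiness premise is needed because \<^const>\<open>Max\<close> of the empty set is unspecified;
  a point with no admissible index satisfies the condition.\<close>

definition active :: "nat \<Rightarrow> (nat \<Rightarrow> real ^ 'n ^ 'n) \<Rightarrow> real ^ 'n \<Rightarrow> nat set"
  where "active m A x = {i \<in> {1..m}. quad_form (A i) x \<noteq> 0}"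

definition max_condition :: "(nat \<Rightarrow> 'n) \<Rightarrow> nat \<Rightarrow> (nat \<Rightarrow> real ^ 'n ^ 'n) \<Rightarrow> bool"
  where "max_condition e m A \<longleftrightarrow>
    (\<forall>x :: real ^ 'n. norm x = 1 \<and> x $ e CARD('n) < 0 \<longrightarrow> active m A x \<noteq> {} \<longrightarrow>
       (MAX i\<in>active m A x. x $ e i * quad_form (A i) x) \<ge> 0)"

end

theory Submission
  imports Defs
begin

text \<open>It suffices to find a common zero \<open>x \<noteq> 0\<close> of the quadratic forms, as then \<open>x x\<^sup>T\<close> is a
  rank-one solution. If there were none, the vector of their values on the hyperplane \<open>x\<^sub>n = -1\<close>,
  padded with zeros, would be a nowhere vanishing continuous field on the unit ball. By Brouwer's
  theorem such a field points radially inwards at some boundary point, and there \<open>x\<^sub>i (x\<^sup>T A\<^sub>i x) < 0\<close>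
  for every active \<open>i\<close>, contradicting the hypothesis after normalisation of \<open>x\<close>.\<close>

text \<open>Apply Brouwer to the normalised opposite field \<open>g\<close>. Since \<open>g\<close>
  takes values in the unit sphere, its fixed point lies on the boundary, and there \<open>f\<close>
  is \<open>- norm (f z)\<close> times \<open>z\<close>.\<close>

lemma nonvanishing_field_points_inwards:
  fixes f :: "'a::euclidean_space \<Rightarrow> 'a"
  assumes cont: "continuous_on (cball 0 1) f"
    and nz: "\<And>z. z \<in> cball 0 1 \<Longrightarrow> f z \<noteq> 0"
  obtains z c where "norm z = 1" "0 < c" "f z = - c *\<^sub>R z"
proof -
  define g where "g z = - (f z /\<^sub>R norm (f z))" for z
  have "continuous_on (cball 0 1) g"
    unfolding g_def by (intro continuous_intros cont) (use nz in auto)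
  moreover have norm_g: "norm (g z) = 1" if "z \<in> cball 0 1" for z
    using nz[OF that] by (simp add: g_def)
  ultimately obtain z where z: "z \<in> cball 0 1" "g z = z"
    by (metis (no_types, lifting) brouwer_ball[of 1 0 g] image_subsetI mem_cball_0 order_refl
        zero_less_one Pi_I)
  show thesis
  proof
    show "norm z = 1" using norm_g z by metis
    show "0 < norm (f z)" using nz z by simp
    have "f z = - norm (f z) *\<^sub>R g z" using nz[OF z(1)] by (simp add: g_def)
    then show "f z = - norm (f z) *\<^sub>R z" using z by simp
  qed
qed

definition outer :: "real ^ 'n \<Rightarrow> real ^ 'n ^ 'n"
  where "outer x = (\<chi> i j. x $ i * x $ j)"

lemma outer_mult_vec: "outer x *v v = (x \<bullet> v) *\<^sub>R x"
  by (simp add: vec_eq_iff outer_def matrix_vector_mult_def inner_vec_def sum_distrib_left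
      mult_ac)

lemma outer_in_sym_mats: "outer x \<in> sym_mats"
  by (simp add: sym_mats_def outer_def transpose_def vec_eq_iff mult.commute)

lemma pos_semidef_outer: "pos_semidef (outer x)"
  by (simp add: pos_semidef_def outer_mult_vec inner_commute)

lemma mat_inner_outer: "mat_inner A (outer x) = quad_form A x"
proof -
  have "mat_inner A (outer x) = (\<Sum>i\<in>UNIV. \<Sum>k\<in>UNIV. A $ k $ i * (x $ k * x $ i))"
    by (simp add: mat_inner_def trace_def transpose_def matrix_matrix_mult_def outer_def)
  also have "\<dots> = (\<Sum>k\<in>UNIV. \<Sum>i\<in>UNIV. A $ k $ i * (x $ k * x $ i))"
    by (rule sum.swap)
  also have "\<dots> = quad_form A x"
    by (simp add: quad_form_def inner_vec_def matrix_vector_mult_def sum_distrib_left mult_ac)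
  finally show ?thesis .
qed

lemma rank_outer:
  assumes "x \<noteq> 0"
  shows "rank (outer x) = 1"
proof -
  have "range ((*v) (outer x)) = span {x}"
  proof -
    \<comment> \<open>The coefficient of the preimage is chosen so that its inner product with
      \<open>x\<close> is exactly \<open>c\<close>.\<close>
    have "c *\<^sub>R x \<in> range (\<lambda>v. (x \<bullet> v) *\<^sub>R x)" for c
      using assms by (intro range_eqI[of _ _ "(c / (x \<bullet> x)) *\<^sub>R x"]) simp
    then show ?thesis
      by (auto simp: outer_mult_vec span_singleton)
  qed
  then show ?thesis
    using assms by (simp add: rank_dim_range)
qed

lemma quad_form_scaleR: "quad_form A (c *\<^sub>R x) = c\<^sup>2 * quad_form A x"
  by (simp add: quad_form_def scaleR_matrix_vector_assoc[symmetric] matrix_vector_mult_scaleR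
      power2_eq_square)

lemma continuous_on_quad_form [continuous_intros]:
  "continuous_on S f \<Longrightarrow> continuous_on S (\<lambda>x. quad_form A (f x))"
  unfolding quad_form_def
  by (intro continuous_intros bounded_linear.continuous_on[OF matrix_vector_mul_bounded_linear])

text \<open>This removes the restriction to unit vectors. Scaling by a positive \<open>c\<close>
  preserves the sign of the last coordinate and the active set, and it multiplies each product by
  \<open>c ^ 3\<close>: one factor from the coordinate and two from the quadratic form.\<close>

lemma max_condition_homogeneous:
  fixes A :: "nat \<Rightarrow> real ^ 'n ^ 'n"
  assumes "max_condition e m A" and neg: "x $ e CARD('n) < 0" and ne: "active m A x \<noteq> {}"
  obtains i where "i \<in> active m A x" "0 \<le> x $ e i * quad_form (A i) x"
proof -
  define c where "c = inverse (norm x)"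
  have "x \<noteq> 0" using neg by auto
  then have c: "c > 0" and nrm: "norm (c *\<^sub>R x) = 1" by (simp_all add: c_def)
  have act: "active m A (c *\<^sub>R x) = active m A x"
    using c by (simp add: active_def quad_form_scaleR)
  have fin: "finite (active m A x)" by (simp add: active_def)
  have "(c *\<^sub>R x) $ e CARD('n) < 0"
    using neg c by (simp add: mult_pos_neg)
  then have "0 \<le> (MAX i\<in>active m A x. (c *\<^sub>R x) $ e i * quad_form (A i) (c *\<^sub>R x))"
    using assms(1) ne nrm act unfolding max_condition_def by metis
  then obtain i where i: "i \<in> active m A x"
      "0 \<le> (c *\<^sub>R x) $ e i * quad_form (A i) (c *\<^sub>R x)"
    using fin ne by (auto simp: Max_ge_iff)
  have "(c *\<^sub>R x) $ e i * quad_form (A i) (c *\<^sub>R x) = c ^ 3 * (x $ e i * quad_form (A i) x)"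
    by (simp add: quad_form_scaleR power2_eq_square power3_eq_cube)
  with i(2) have "0 \<le> c ^ 3 * (x $ e i * quad_form (A i) x)" by argo
  then have "0 \<le> x $ e i * quad_form (A i) x"
    using zero_le_mult_iff zero_less_power[OF c] by (metis not_le)
  with i(1) show thesis by (rule that)
qed

lemma common_zero:
  fixes A :: "nat \<Rightarrow> real ^ 'n ^ 'n" and e :: "nat \<Rightarrow> 'n"
  assumes bij: "bij_betw e {1..CARD('n)} UNIV"
    and m: "m + 1 \<le> CARD('n)"
    and max: "max_condition e m A"
  obtains x where "x \<noteq> 0" "active m A x = {}"
proof (rule ccontr)
  assume "\<not> thesis"
  with that have act: "active m A x \<noteq> {}" if "x \<noteq> 0" for x
    using that by blast
  define k where "k = inv_into {1..CARD('n)} e"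
  have k: "k (e i) = i" if "i \<in> {1..CARD('n)}" for i
    using bij that by (simp add: k_def bij_betw_def inv_into_f_f)
  \<comment> \<open>Overwriting the last coordinate, instead of working in one dimension less, keeps
    the ball and the values of the field in the same space, as Brouwer's theorem demands.\<close>
  define p :: "real ^ 'n \<Rightarrow> real ^ 'n"
    where "p z = (\<chi> j. if j = e CARD('n) then - 1 else z $ j)" for z
  define f :: "real ^ 'n \<Rightarrow> real ^ 'n"
    where "f z = (\<chi> j. if k j \<le> m then quad_form (A (k j)) (p z) else 0)" for z
  have p_last: "p z $ e CARD('n) < 0" for z by (simp add: p_def)
  have p_e: "p z $ e i = z $ e i" if "i \<in> {1..m}" for z i
  proof -
    \<comment> \<open>Here \<open>m + 1 \<le> CARD('n)\<close> enters: the first \<open>m\<close>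
      coordinates exclude the last one, so \<open>p\<close> leaves them unchanged.\<close>
    have "e i \<noteq> e CARD('n)" using k[of i] k[of "CARD('n)"] that m by auto
    then show ?thesis by (simp add: p_def)
  qed
  have f_e: "f z $ e i = quad_form (A i) (p z)" if "i \<in> {1..m}" for z i
    using k[of i] that m by (simp add: f_def)
  have "continuous_on UNIV (\<lambda>z. if j = e CARD('n) then - 1 else z $ j)" for j
    by (cases "j = e CARD('n)") (auto intro!: continuous_intros)
  then have cont_p: "continuous_on UNIV p"
    unfolding p_def by (intro continuous_on_vec_lambda)
  have "continuous_on UNIV (\<lambda>z. if k j \<le> m then quad_form (A (k j)) (p z) else 0)" for j
    by (cases "k j \<le> m") (auto intro!: continuous_intros cont_p)
  then have cont_f: "continuous_on (cball 0 1) f"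
    unfolding f_def by (intro continuous_on_vec_lambda) (auto intro: continuous_on_subset)
  have p_nz: "p z \<noteq> 0" for z using p_last[of z] by auto
  \<comment> \<open>By the contrary assumption some form is nonzero at \<open>p z\<close>, and its
    value is a coordinate of \<open>f z\<close>.\<close>
  have "f z \<noteq> 0" for z
  proof -
    obtain i where "i \<in> active m A (p z)" using act[OF p_nz] by blast
    then have "f z $ e i \<noteq> 0" using f_e by (simp add: active_def)
    then show ?thesis by auto
  qed
  then obtain z c where c: "0 < c" and fz: "f z = - c *\<^sub>R z"
    using nonvanishing_field_points_inwards[OF cont_f] by blast
  obtain i where i: "i \<in> active m A (p z)" "0 \<le> p z $ e i * quad_form (A i) (p z)"
    using max_condition_homogeneous[OF max p_last act[OF p_nz]] .
  have im: "i \<in> {1..m}" and nz: "quad_form (A i) (p z) \<noteq> 0"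
    using i(1) by (simp_all add: active_def)
  have q: "quad_form (A i) (p z) = - c * z $ e i"
    using f_e[OF im, of z] fz by simp
  then have "p z $ e i * quad_form (A i) (p z) = - c * (z $ e i)\<^sup>2"
    using p_e[OF im, of z] by (simp add: power2_eq_square)
  \<comment> \<open>The value \<open>- c * z $ e i\<close> of an active form is nonzero, hence so is
    \<open>z $ e i\<close>, and the inequality is strict.\<close>
  also have "\<dots> < 0" using c nz q by simp
  finally show False using i(2) by simp
qed

theorem theorem2p6:
  fixes A :: "nat \<Rightarrow> real ^ 'n ^ 'n"
    and e :: "nat \<Rightarrow> 'n"
    and m :: nat
  assumes "bij_betw e {1..CARD('n)} UNIV"
    and "1 \<le> m"
    and "m + 1 \<le> CARD('n)"
    and "\<forall>i\<in>{1..m}. A i \<in> sym_mats"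
    and "max_condition e m A"
  shows "\<exists>X. is_solution m A X \<and> rank X = 1"
proof -
  obtain x where "x \<noteq> 0" and "active m A x = {}"
    using common_zero assms(1,3,5) .
  \<comment> \<open>An empty active set means that every form vanishes at \<open>x\<close>, and
    these values are the inner products with \<open>outer x\<close>.\<close>
  then have "is_solution m A (outer x) \<and> rank (outer x) = 1"
    by (auto simp: is_solution_def active_def mat_inner_outer pos_semidef_outer
        outer_in_sym_mats rank_outer)
  then show ?thesis by blast
qed

end
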